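(* Let $\mathcal K=\{1\}$ (paths), let flowers be non-plane, and let $\mathcal N\subseteq\mathbb N^*$ be nonempty and finite. Then $$[z^n]R(z)\sim[z^n]R^*(z)\sim\Big(\prod_{m\in\mathcal N}\frac1m\Big)\frac{n^{|\mathcal N|}}{|\mathcal N|!}.$$ Also, for the class $\mathcal R$, $$[z^n]\Omega(z)\sim\frac1{(|\mathcal N|+1)!}\Big(\prod_{m\in\mathcal N}\frac1m\Big)\Big(\sum_{m\in\mathcal N}\frac1m\Big)n^{|\mathcal N|+1}\ \text{ for }\chi,\qquad [z^n]\Omega(z)\sim\frac{|\mathcal N|}{(|\mathcal N|+1)!}\Big(\prod_{m\in\mathcal N}\frac1m\Big)n^{|\mathcal N|+1}\ \text{ for }\xi,$$ hence $\mathbb E_{\mathcal R_n}(\chi)\sim\frac1{|\mathcal N|+1}\Big(\sum_{m\in\mathcal N}\frac1m\Big)n$ and $\mathbb E_{\mathcal R_n}(\xi)\sim\frac{|\mathcal N|}{|\mathcal N|+1}n$.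
   Context: Non-plane $\mathcal N$-flowers are integer partitions with all parts (petals) in $\mathcal N$, with generating function $F(z)=\prod_{m\in\mathcal N}(1-z^m)^{-1}$; the size of a flower is the sum of its parts. A path with a flower on the leaf has size equal to the path length plus the flower size; the class $\mathcal R$ has generating function $R(z)=F(z)/(1-z)$, and $\mathcal R^*$ (nonempty flower required) has $R^*(z)=(F(z)-1)/(1-z)$. The parameter $\chi$ is the number of petals (parts) and $\xi$ the number of edges in petals (flower size); their bivariate flower generating functions are $F(z,u)=\prod_{m\in\mathcal N}(1-uz^m)^{-1}$ and $F(z,u)=F(uz)$ respectively, $F_u(z)=\partial_uF(z,u)|_{u=1}$, and $\Omega(z)=F_u(z)/(1-z)$ is the cumulative generating function of the parameter on $\mathcal R$. $\mathbb E_{\mathcal R_n}(\kappa)=[z^n]\Omega(z)/[z^n]R(z)$ is the mean of $\kappa$ over objects of size $n$ in $\mathcal R$. *)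

theory Defs
  imports
    Complex_Main
    "HOL-Library.Multiset"
    "HOL-Library.Landau_Symbols"
    "HOL-Computational_Algebra.Polynomial"
    "HOL-Computational_Algebra.Formal_Power_Series"
begin

section \<open>Non-plane flowers and paths carrying a flower\<close>

text \<open>
  A non-plane flower is the multiset of the lengths of its petals. The petal lengths are positive
  integers, so the hypothesis \<open>0 \<notin> N\<close> accompanies every use of a set \<open>N\<close> of admissible lengths.
\<close>

type_synonym flower = "nat multiset"

definition flowers :: "nat set \<Rightarrow> flower set" where
  "flowers N = {p. set_mset p \<subseteq> N}"

definition petals :: "flower \<Rightarrow> nat" where
  "petals p = size p"

definition petal_edges :: "flower \<Rightarrow> nat" where
  "petal_edges p = sum_mset p"

abbreviation flower_size :: "flower \<Rightarrow> nat" where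
  "flower_size \<equiv> petal_edges"

text \<open>
  An object \<open>(k, p)\<close> is a path with \<open>k \<ge> 0\<close> edges whose leaf carries the flower \<open>p\<close>.
\<close>

definition R_class :: "nat set \<Rightarrow> (nat \<times> flower) set" where
  "R_class N = UNIV \<times> flowers N"

definition Rstar_class :: "nat set \<Rightarrow> (nat \<times> flower) set" where
  "Rstar_class N = UNIV \<times> (flowers N - {{#}})"

definition path_size :: "nat \<times> flower \<Rightarrow> nat" where
  "path_size x = fst x + flower_size (snd x)"

section \<open>Generating functions\<close>

definition gf :: "('a \<Rightarrow> nat) \<Rightarrow> 'a set \<Rightarrow> real fps" where
  "gf sz A = Abs_fps (\<lambda>n. real (card {x \<in> A. sz x = n}))"

text \<open>
  Bivariate generating functions are power series in \<open>z\<close> whose coefficients are polynomials in the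
  variable \<open>u\<close>, which marks the parameter \<open>\<kappa>\<close>.
\<close>

definition bgf :: "('a \<Rightarrow> nat) \<Rightarrow> ('a \<Rightarrow> nat) \<Rightarrow> 'a set \<Rightarrow> real poly fps" where
  "bgf sz \<kappa> A = Abs_fps (\<lambda>n. \<Sum>x | x \<in> A \<and> sz x = n. monom 1 (\<kappa> x))"

definition deriv_u_at_1 :: "real poly fps \<Rightarrow> real fps" where
  "deriv_u_at_1 G = Abs_fps (\<lambda>n. poly (pderiv (fps_nth G n)) 1)"

definition F_gf :: "nat set \<Rightarrow> real fps" where
  "F_gf N = gf flower_size (flowers N)"

definition F_bgf :: "(flower \<Rightarrow> nat) \<Rightarrow> nat set \<Rightarrow> real poly fps" where
  "F_bgf \<kappa> N = bgf flower_size \<kappa> (flowers N)"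

definition R_gf :: "nat set \<Rightarrow> real fps" where
  "R_gf N = gf path_size (R_class N)"

definition Rstar_gf :: "nat set \<Rightarrow> real fps" where
  "Rstar_gf N = gf path_size (Rstar_class N)"

definition Omega_gf :: "(flower \<Rightarrow> nat) \<Rightarrow> nat set \<Rightarrow> real fps" where
  "Omega_gf \<kappa> N = deriv_u_at_1 (F_bgf \<kappa> N) / (1 - fps_X)"

definition R_mean :: "(flower \<Rightarrow> nat) \<Rightarrow> nat set \<Rightarrow> nat \<Rightarrow> real" where
  "R_mean \<kappa> N n = fps_nth (Omega_gf \<kappa> N) n / fps_nth (R_gf N) n"

section \<open>The closed forms of the generating functions\<close>

lemma size_le_sum_mset:
  fixes p :: "nat multiset"
  assumes "0 \<notin># p"
  shows "size p \<le> sum_mset p"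
  using assms by (induction p) auto

lemma finite_flowers_of_size:
  assumes "0 \<notin> N"
  shows "finite {p \<in> flowers N. flower_size p = n}"
proof (rule finite_subset)
  show "{p \<in> flowers N. flower_size p = n} \<subseteq> mset ` {xs. set xs \<subseteq> {..n} \<and> length xs \<le> n}"
  proof
    fix p assume "p \<in> {p \<in> flowers N. flower_size p = n}"
    hence p: "set_mset p \<subseteq> N" "sum_mset p = n"
      by (auto simp: flowers_def petal_edges_def)
    obtain xs where xs: "p = mset xs" by (metis ex_mset)
    have "length xs \<le> n"
      using size_le_sum_mset[of p] p assms xs by auto
    moreover have "x \<le> n" if "x \<in> set xs" for x
      using that p(2) xs member_le_sum_list[of x xs] by (auto simp: sum_mset_sum_list)
    ultimately show "p \<in> mset ` {xs. set xs \<subseteq> {..n} \<and> length xs \<le> n}"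
      using xs by blast
  qed
  show "finite (mset ` {xs. set xs \<subseteq> {..n} \<and> length xs \<le> n})"
    by (intro finite_imageI finite_lists_length_le) auto
qed

definition flower_wgf :: "'a::comm_ring_1 \<Rightarrow> nat set \<Rightarrow> 'a fps" where
  "flower_wgf w N = Abs_fps (\<lambda>n. \<Sum>p | p \<in> flowers N \<and> flower_size p = n. w ^ size p)"

lemma flower_wgf_empty: "flower_wgf w {} = 1"
proof (rule fps_ext)
  fix n
  have "{p. p \<in> flowers {} \<and> flower_size p = n} = (if n = 0 then {{#}} else {})"
    by (auto simp: flowers_def petal_edges_def)
  thus "fps_nth (flower_wgf w {}) n = fps_nth 1 n"
    by (simp add: flower_wgf_def)
qed

lemma flower_wgf_insert:
  assumes "0 \<notin> N" "m \<noteq> 0" "m \<notin> N"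
  shows "flower_wgf w (insert m N) * (1 - fps_const w * fps_X ^ m) = flower_wgf w N"
proof (rule fps_ext)
  fix n
  let ?A = "\<lambda>n. {p. p \<in> flowers (insert m N) \<and> flower_size p = n}"
  let ?B = "{p. p \<in> flowers N \<and> flower_size p = n}"
  let ?C = "{p \<in> ?A n. m \<in># p}"
  have fin: "finite (?A k)" for k
    using finite_flowers_of_size[of "insert m N" k] assms by simp
  have split: "?A n = ?B \<union> ?C" "?B \<inter> ?C = {}"
    using assms(3) by (auto simp: flowers_def)
  have finB: "finite ?B" and finC: "finite ?C"
    using fin[of n] split(1) by (auto intro: finite_subset)
  have "(\<Sum>p\<in>?A n. w ^ size p) = (\<Sum>p\<in>?B. w ^ size p) + (\<Sum>p\<in>?C. w ^ size p)"
    by (subst split(1), rule sum.union_disjoint[OF finB finC split(2)])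
  moreover have "(\<Sum>p\<in>?C. w ^ size p) =
                   (if n < m then 0 else w * (\<Sum>p\<in>?A (n - m). w ^ size p))"
  proof (cases "n < m")
    case True
    have "?C = {}"
      using True by (auto simp: petal_edges_def dest!: multi_member_split)
    thus ?thesis using True by (simp only: sum.empty if_True)
  next
    case False
    have "(\<Sum>p\<in>?C. w ^ size p) = (\<Sum>p\<in>?A (n - m). w ^ size (add_mset m p))"
    proof (rule sum.reindex_bij_witness[where i = "add_mset m" and j = "\<lambda>p. p - {#m#}"], goal_cases)
      case (2 p)
      then obtain q where "p = add_mset m q" by (auto dest: multi_member_split)
      with 2 False show ?case by (auto simp: flowers_def petal_edges_def)
    qed (use False in \<open>auto simp: flowers_def petal_edges_def\<close>)
    thus ?thesis using False by (simp add: sum_distrib_left)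
  qed
  moreover have *: "G * (1 - fps_const w * fps_X ^ m) = G - fps_const w * (G * fps_X ^ m)" for G
    by (simp add: algebra_simps)
  ultimately show "fps_nth (flower_wgf w (insert m N) * (1 - fps_const w * fps_X ^ m)) n =
                     fps_nth (flower_wgf w N) n"
    by (subst *) (simp add: flower_wgf_def fps_X_power_mult_right_nth)
qed

lemma flower_wgf_prod:
  assumes "finite N" "0 \<notin> N"
  shows "flower_wgf w N * (\<Prod>m\<in>N. 1 - fps_const w * fps_X ^ m) = 1"
  using assms
proof (induction N rule: finite_induct)
  case (insert m N)
  have "flower_wgf w (insert m N) * (1 - fps_const w * fps_X ^ m) = flower_wgf w N"
    using insert by (intro flower_wgf_insert) auto
  thus ?case using insert by (simp add: mult.assoc[symmetric])
qed (simp add: flower_wgf_empty)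

lemma F_gf_eq:
  assumes "finite N" "0 \<notin> N"
  shows "F_gf N = (\<Prod>m\<in>N. inverse (1 - fps_X ^ m))"
proof -
  have "F_gf N = flower_wgf 1 N"
    by (simp add: F_gf_def gf_def flower_wgf_def)
  hence 1: "F_gf N * (\<Prod>m\<in>N. 1 - fps_X ^ m) = 1"
    using flower_wgf_prod[OF assms, of "1::real"] by simp
  have "(1 - fps_X ^ m) * inverse (1 - fps_X ^ m :: real fps) = 1" if "m \<in> N" for m
  proof -
    have "fps_nth (1 - fps_X ^ m :: real fps) 0 \<noteq> 0"
      using that assms(2) by (cases "m = 0") auto
    thus ?thesis by (rule inverse_mult_eq_1')
  qed
  hence "(\<Prod>m\<in>N. 1 - fps_X ^ m) * (\<Prod>m\<in>N. inverse (1 - fps_X ^ m :: real fps)) = 1"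
    by (subst prod.distrib[symmetric]) (rule prod.neutral, blast)
  thus ?thesis
    using 1 by (metis (no_types) mult.assoc mult.commute mult.right_neutral)
qed

text \<open>
  The coefficient ring \<open>real poly\<close> has no inverses, so the identity
  \<open>F(z,u) = (\<Prod>m\<in>N. 1 / (1 - u z^m))\<close> is stated without division.
\<close>

lemma F_bgf_petals:
  assumes "finite N" "0 \<notin> N"
  shows "F_bgf petals N * (\<Prod>m\<in>N. 1 - fps_const (monom 1 1) * fps_X ^ m) = 1"
proof -
  have "F_bgf petals N = flower_wgf (monom 1 1) N"
    by (simp add: F_bgf_def bgf_def flower_wgf_def monom_power petals_def)
  thus ?thesis using flower_wgf_prod[OF assms] by simp
qed

text \<open>For the number of petal edges, \<open>F(z,u) = F(uz)\<close> reads as follows on coefficients.\<close>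

lemma F_bgf_petal_edges:
  "F_bgf petal_edges N = Abs_fps (\<lambda>n. monom (fps_nth (F_gf N) n) n)"
  by (simp add: F_bgf_def bgf_def F_gf_def gf_def of_nat_monom mult_monom of_nat_poly
      smult_monom flip: of_nat_mult)

lemma divide_one_minus_X_nth:
  fixes f :: "real fps"
  shows "fps_nth (f / (1 - fps_X)) n = (\<Sum>i\<le>n. fps_nth f i)"
proof -
  have "f / (1 - fps_X) = f * Abs_fps (\<lambda>_. 1)"
    by (simp add: fps_divide_unit fps_inverse_gp'[symmetric])
  thus ?thesis by (simp add: fps_mult_nth atLeast0AtMost)
qed

lemma sum_paths_of_size:
  fixes h :: "flower \<Rightarrow> real"
  assumes "0 \<notin> N" "S \<subseteq> flowers N"
  shows "finite {x \<in> UNIV \<times> S. path_size x = n}"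
    and "(\<Sum>x | x \<in> UNIV \<times> S \<and> path_size x = n. h (snd x)) =
           (\<Sum>i\<le>n. \<Sum>p | p \<in> S \<and> flower_size p = i. h p)"
proof -
  have fin: "finite {p \<in> S. flower_size p = i}" for i
    using finite_flowers_of_size[OF assms(1), of i] by (rule rev_finite_subset) (use assms in auto)
  let ?T = "SIGMA i:{..n}. {p. p \<in> S \<and> flower_size p = i}"
  have bij: "bij_betw (\<lambda>(i, p). (n - i, p)) ?T {x. x \<in> UNIV \<times> S \<and> path_size x = n}"
    by (rule bij_betwI[where g = "\<lambda>(k, p). (n - k, p)"]) (auto simp: path_size_def)
  have "finite ?T" using fin by auto
  thus "finite {x \<in> UNIV \<times> S. path_size x = n}"
    using bij_betw_finite[OF bij] by simp
  have "(\<Sum>x | x \<in> UNIV \<times> S \<and> path_size x = n. h (snd x)) = (\<Sum>(i, p)\<in>?T. h p)"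
    by (subst sum.reindex_bij_betw[OF bij, symmetric]) (auto intro!: sum.cong)
  also have "\<dots> = (\<Sum>i\<le>n. \<Sum>p | p \<in> S \<and> flower_size p = i. h p)"
    by (rule sum.Sigma[symmetric]) (use fin in auto)
  finally show "(\<Sum>x | x \<in> UNIV \<times> S \<and> path_size x = n. h (snd x)) =
           (\<Sum>i\<le>n. \<Sum>p | p \<in> S \<and> flower_size p = i. h p)" .
qed

lemma R_gf_eq:
  assumes "0 \<notin> N"
  shows "R_gf N = F_gf N / (1 - fps_X)"
  by (rule fps_ext, subst divide_one_minus_X_nth)
    (use sum_paths_of_size(2)[OF assms subset_refl, where h = "\<lambda>_. 1"]
      in \<open>simp add: R_gf_def F_gf_def gf_def R_class_def\<close>)

lemma Rstar_gf_eq: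
  assumes "0 \<notin> N"
  shows "Rstar_gf N = (F_gf N - 1) / (1 - fps_X)"
proof (rule fps_ext, subst divide_one_minus_X_nth)
  fix n
  have "real (card {p \<in> flowers N - {{#}}. flower_size p = i}) = fps_nth (F_gf N - 1) i" for i
  proof (cases "i = 0")
    case True
    have "{p \<in> flowers N - {{#}}. flower_size p = 0} = {}" "{p \<in> flowers N. flower_size p = 0} = {{#}}"
      using assms by (auto simp: flowers_def petal_edges_def multiset_eq_iff)
        (metis count_eq_zero_iff subset_iff)+
    thus ?thesis using True by (simp only: F_gf_def gf_def) simp
  next
    case False
    have "{p \<in> flowers N - {{#}}. flower_size p = i} = {p \<in> flowers N. flower_size p = i}"
      using False by (auto simp: petal_edges_def)
    thus ?thesis using False by (simp add: F_gf_def gf_def)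
  qed
  thus "fps_nth (Rstar_gf N) n = (\<Sum>i\<le>n. fps_nth (F_gf N - 1) i)"
    using sum_paths_of_size(2)[OF assms Diff_subset[of "flowers N" "{{#}}"], where h = "\<lambda>_. 1" and n = n]
    by (simp add: Rstar_gf_def gf_def Rstar_class_def)
qed

lemma Omega_gf_nth:
  assumes "0 \<notin> N"
  shows "fps_nth (Omega_gf \<kappa> N) n =
           (\<Sum>x | x \<in> R_class N \<and> path_size x = n. real (\<kappa> (snd x)))"
proof -
  have "fps_nth (deriv_u_at_1 (F_bgf \<kappa> N)) i =
          (\<Sum>p | p \<in> flowers N \<and> flower_size p = i. real (\<kappa> p))" for i
    using higher_pderiv_sum[of 1 "\<lambda>p. monom (1::real) (\<kappa> p)"]
    by (simp add: deriv_u_at_1_def F_bgf_def bgf_def poly_sum pderiv_monom poly_monom)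
  thus ?thesis
    using sum_paths_of_size(2)[OF assms subset_refl, where h = "\<lambda>p. real (\<kappa> p)" and n = n]
    by (simp add: Omega_gf_def divide_one_minus_X_nth R_class_def)
qed

lemma R_mean_eq_average:
  assumes "0 \<notin> N"
  shows "R_mean \<kappa> N n = (\<Sum>x | x \<in> R_class N \<and> path_size x = n. real (\<kappa> (snd x))) /
                          real (card {x \<in> R_class N. path_size x = n})"
  by (simp add: R_mean_def Omega_gf_nth[OF assms] R_gf_def gf_def)

end

theory Submission
  imports Defs
begin

text \<open>
  Splitting off one petal of length \<open>m\<close> gives the recurrence
  \<open>s (n) = s' (n) + s (n - m)\<close> between the numbers of objects with petals in \<open>N \<union> {m}\<close> and in
  \<open>N\<close>. Such a recurrence turns \<open>s' (n) \<sim> c n^k\<close> into \<open>s (n) \<sim> c n^(k+1) / (m (k+1))\<close>.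
  Both parameters are additive, assigning to each petal of length \<open>m\<close> a weight (\<open>1\<close> for the number
  of petals, \<open>m\<close> for the number of petal edges). Their cumulative sums satisfy the same kind of
  recurrence, so that all asymptotics follow by induction on the set \<open>N\<close>.
\<close>

section \<open>Recurrences with a fixed step\<close>

text \<open>Going down from \<open>n\<close> in steps of \<open>m\<close> takes at most
  \<open>n\<close> steps, and each late increment is at most \<open>\<epsilon> * n ^ k\<close>.
  Together they contribute at most \<open>\<epsilon> * n ^ Suc k\<close>, while the finitely many
  initial values only add a constant.\<close>

lemma step_recurrence_tendsto_0:
  fixes e d :: "nat \<Rightarrow> real"
  assumes m: "m > 0"
    and rec: "\<And>n. n \<ge> m \<Longrightarrow> e n = e (n - m) + d n"
    and d: "(\<lambda>n. d n / real n ^ k) \<longlonglongrightarrow> 0"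
  shows "(\<lambda>n. e n / real n ^ Suc k) \<longlonglongrightarrow> 0"
proof (rule LIMSEQ_I)
  fix r :: real assume r: "r > 0"
  define \<epsilon> where "\<epsilon> = r / 2"
  have \<epsilon>: "\<epsilon> > 0" using r by (simp add: \<epsilon>_def)
  obtain n0 where n0: "\<And>n. n \<ge> n0 \<Longrightarrow> norm (d n / real n ^ k - 0) < \<epsilon>"
    using LIMSEQ_D[OF d \<epsilon>] by blast
  define n1 where "n1 = n0 + m"
  define C where "C = (\<Sum>i<n1. \<bar>e i\<bar>)"
  have bound: "\<bar>e n\<bar> \<le> C + \<epsilon> * real n ^ Suc k" for n
  proof (induction n rule: less_induct)
    case (less n)
    show ?case
    proof (cases "n < n1")
      case True
      hence "\<bar>e n\<bar> \<le> C" unfolding C_def by (intro member_le_sum) auto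
      moreover have "0 \<le> \<epsilon> * real n ^ Suc k" using \<epsilon> by simp
      ultimately show ?thesis by linarith
    next
      case False
      hence n: "n \<ge> m" "n \<ge> n0" "n > 0" using m by (auto simp: n1_def)
      have "\<bar>d n\<bar> / real n ^ k < \<epsilon>" using n0[of n] n by (simp add: power_abs)
      hence dn: "\<bar>d n\<bar> \<le> \<epsilon> * real n ^ k" using n by (simp add: divide_simps)
      \<comment> \<open>Since \<open>m \<ge> 1\<close>, one factor drops to at most
        \<open>n - 1\<close>. This frees exactly the \<open>n ^ k\<close> that absorbs the increment
        \<open>d n\<close>, so \<open>C\<close> stays the same throughout the induction.\<close>
      have "real (n - m) ^ Suc k \<le> (real n - 1) * real n ^ k"
        unfolding power_Suc using n m by (intro mult_mono power_mono) auto
      hence step: "real (n - m) ^ Suc k + real n ^ k \<le> real n ^ Suc k"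
        by (simp add: algebra_simps)
      have "\<bar>e n\<bar> \<le> \<bar>e (n - m)\<bar> + \<bar>d n\<bar>" using rec[of n] n by simp
      also have "\<dots> \<le> C + \<epsilon> * real (n - m) ^ Suc k + \<epsilon> * real n ^ k"
        using less.IH[of "n - m"] n m dn by simp
      also have "\<dots> = C + \<epsilon> * (real (n - m) ^ Suc k + real n ^ k)"
        by (simp add: algebra_simps)
      also have "\<dots> \<le> C + \<epsilon> * real n ^ Suc k"
        using step \<epsilon> by (intro add_left_mono mult_left_mono) auto
      finally show ?thesis .
    qed
  qed
  \<comment> \<open>Beyond \<open>n2\<close> the constant \<open>C\<close> is below
    \<open>\<epsilon> * n ^ Suc k\<close> as well; the two halves of \<open>r\<close> add
    up.\<close>
  obtain n2 :: nat where n2: "real n2 > C / \<epsilon>" using reals_Archimedean2 by blast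
  have "norm (e n / real n ^ Suc k - 0) < r" if "n \<ge> Suc n2" for n
  proof -
    have n: "n > 0" "real n > C / \<epsilon>" using that n2 by auto
    have "C < \<epsilon> * real n" using n(2) \<epsilon> by (simp add: field_simps)
    also have "\<dots> \<le> \<epsilon> * real n ^ Suc k"
      using n \<epsilon> self_le_power[of "real n" "Suc k"] by (intro mult_left_mono) auto
    finally have "\<bar>e n\<bar> < r * real n ^ Suc k"
      using bound[of n] by (simp add: \<epsilon>_def)
    thus ?thesis using n by (simp add: power_abs abs_mult divide_simps del: power_Suc)
  qed
  thus "\<exists>no. \<forall>n\<ge>no. norm (e n / real n ^ Suc k - 0) < r" by blast
qed

text \<open>With \<open>q = 1 - h / n\<close> the quotient is \<open>n * (1 - q ^ Suc k)\<close>,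
  which is \<open>h\<close> times a geometric sum of \<open>Suc k\<close> powers of
  \<open>q\<close>, each tending to 1.\<close>

lemma power_backward_difference_tendsto:
  fixes h :: real
  shows "(\<lambda>n. (real n ^ Suc k - (real n - h) ^ Suc k) / real n ^ k) \<longlonglongrightarrow> h * real (Suc k)"
proof -
  have "(\<lambda>n. 1 - h / real n) \<longlonglongrightarrow> 1 - 0"
    by (intro tendsto_intros lim_const_over_n)
  hence "(\<lambda>n. h * (\<Sum>i<Suc k. (1 - h / real n) ^ i)) \<longlonglongrightarrow> h * (\<Sum>i<Suc k. (1 - 0) ^ i)"
    by (intro tendsto_intros)
  moreover have "eventually (\<lambda>n. h * (\<Sum>i<Suc k. (1 - h / real n) ^ i) =
      (real n ^ Suc k - (real n - h) ^ Suc k) / real n ^ k) sequentially"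
    using eventually_gt_at_top[of 0]
  proof eventually_elim
    case (elim n)
    let ?q = "1 - h / real n"
    have q: "real n - h = real n * ?q" using elim by (simp add: field_simps)
    have "(1 - ?q) * (\<Sum>i<Suc k. ?q ^ i) = 1 - ?q ^ Suc k"
      by (rule one_diff_power_eq[symmetric])
    hence "h * (\<Sum>i<Suc k. ?q ^ i) = real n * (1 - ?q ^ Suc k)"
      using elim by (simp add: field_simps del: sum.lessThan_Suc power_Suc)
    also have "\<dots> = (real n ^ Suc k - (real n - h) ^ Suc k) / real n ^ k"
      unfolding q power_mult_distrib using elim by (simp add: field_simps)
    finally show ?case .
  qed
  ultimately show ?thesis using Lim_transform_eventually by fastforce
qed

text \<open>The comparison sequence \<open>c' * n ^ Suc k\<close> has backward differences
  asymptotic to \<open>c * n ^ k\<close> when \<open>c' = c / (m * Suc k)\<close>. Subtracting it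
  from \<open>b\<close> leaves a recurrence with increments of order o(\<open>n ^ k\<close>),
  covered by \<open>step_recurrence_tendsto_0\<close>.\<close>

lemma step_recurrence_tendsto:
  fixes a b :: "nat \<Rightarrow> real"
  assumes m: "m > 0"
    and rec: "\<And>n. n \<ge> m \<Longrightarrow> b n = b (n - m) + a n"
    and a: "(\<lambda>n. a n / real n ^ k) \<longlonglongrightarrow> c"
  shows "(\<lambda>n. b n / real n ^ Suc k) \<longlonglongrightarrow> c / (real m * real (Suc k))"
proof -
  define c' where "c' = c / (real m * real (Suc k))"
  \<comment> \<open>The subtraction is real, not truncated, so the limit of the backward differences
    applies as stated; it agrees with \<open>real (n - m)\<close> in the range
    \<open>n \<ge> m\<close> of the recurrence.\<close>
  define d where "d = (\<lambda>n. a n - c' * (real n ^ Suc k - (real n - real m) ^ Suc k))"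
  have "(\<lambda>n. a n / real n ^ k - c' * ((real n ^ Suc k - (real n - real m) ^ Suc k) / real n ^ k))
      \<longlonglongrightarrow> c - c' * (real m * real (Suc k))"
    by (intro tendsto_intros a power_backward_difference_tendsto)
  moreover have "c - c' * (real m * real (Suc k)) = 0"
    using m by (simp add: c'_def del: of_nat_Suc)
  ultimately have d: "(\<lambda>n. d n / real n ^ k) \<longlonglongrightarrow> 0"
    unfolding d_def by (simp only: diff_divide_distrib[of "a n" for n] times_divide_eq_right)
  have "(\<lambda>n. (b n - c' * real n ^ Suc k) / real n ^ Suc k) \<longlonglongrightarrow> 0"
    by (rule step_recurrence_tendsto_0[OF m _ d])
      (simp add: rec d_def of_nat_diff algebra_simps del: power_Suc)
  hence "(\<lambda>n. (b n - c' * real n ^ Suc k) / real n ^ Suc k + c') \<longlonglongrightarrow> 0 + c'"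
    by (intro tendsto_intros)
  moreover have "eventually (\<lambda>n. (b n - c' * real n ^ Suc k) / real n ^ Suc k + c' =
      b n / real n ^ Suc k) sequentially"
    using eventually_gt_at_top[of 0] by eventually_elim (simp add: field_simps)
  ultimately show ?thesis
    unfolding c'_def[symmetric] using Lim_transform_eventually by fastforce
qed

lemma asymp_equiv_powerI:
  fixes f :: "nat \<Rightarrow> real"
  assumes "(\<lambda>n. f n / real n ^ k) \<longlonglongrightarrow> c" and "c \<noteq> 0"
  shows "f \<sim>[at_top] (\<lambda>n. c * real n ^ k)"
proof (rule asymp_equivI')
  have "(\<lambda>n. f n / real n ^ k / c) \<longlonglongrightarrow> c / c"
    using assms by (intro tendsto_intros) auto
  thus "(\<lambda>n. f n / (c * real n ^ k)) \<longlonglongrightarrow> 1"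
    using assms(2) by (simp add: mult.commute)
qed

section \<open>Sums over paths with a flower\<close>

text \<open>An arbitrary weight \<open>h\<close> covers counting (\<open>h = 1\<close>) and both
  parameters, and lets the recurrence replace \<open>h\<close> by its composition with
  \<open>add_mset m\<close>.\<close>

definition path_sum :: "(flower \<Rightarrow> real) \<Rightarrow> nat set \<Rightarrow> nat \<Rightarrow> real" where
  "path_sum h N n = (\<Sum>x | x \<in> R_class N \<and> path_size x = n. h (snd x))"

lemma path_sum_empty: "path_sum h {} n = h {#}"
proof -
  have "{x. x \<in> R_class {} \<and> path_size x = n} = {(n, {#})}"
    by (auto simp: R_class_def flowers_def path_size_def petal_edges_def)
  thus ?thesis by (simp add: path_sum_def)
qed

text \<open>Objects are split by whether \<open>m\<close> occurs as a petal. Removing one copy of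
  \<open>m\<close> is a bijection from those containing it onto all objects of size
  \<open>n - m\<close>, which may still contain \<open>m\<close>.\<close>

lemma path_sum_insert:
  assumes "0 \<notin> N" "m \<noteq> 0" "m \<notin> N" "n \<ge> m"
  shows "path_sum h (insert m N) n =
           path_sum h N n + path_sum (\<lambda>p. h (add_mset m p)) (insert m N) (n - m)"
proof -
  let ?A = "\<lambda>n. {x. x \<in> R_class (insert m N) \<and> path_size x = n}"
  let ?B = "{x. x \<in> R_class N \<and> path_size x = n}"
  let ?C = "{x \<in> ?A n. m \<in># snd x}"
  have fin: "finite (?A n)"
    using sum_paths_of_size(1)[of "insert m N" "flowers (insert m N)" n] assms
    by (simp add: R_class_def)
  have split: "?A n = ?B \<union> ?C" "?B \<inter> ?C = {}"
    using assms(3) by (auto simp: R_class_def flowers_def)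
  have finB: "finite ?B" and finC: "finite ?C"
    using fin split(1) by (auto intro: finite_subset)
  have "(\<Sum>x\<in>?A n. h (snd x)) = (\<Sum>x\<in>?B. h (snd x)) + (\<Sum>x\<in>?C. h (snd x))"
    by (subst split(1), rule sum.union_disjoint[OF finB finC split(2)])
  also have "(\<Sum>x\<in>?C. h (snd x)) = (\<Sum>x\<in>?A (n - m). h (add_mset m (snd x)))"
  proof (rule sum.reindex_bij_witness[where i = "apsnd (add_mset m)"
        and j = "apsnd (\<lambda>p. p - {#m#})"], goal_cases)
    case (2 x)
    then obtain q where "snd x = add_mset m q" by (auto dest: multi_member_split)
    with 2 assms(4) show ?case
      by (cases x) (auto simp: R_class_def flowers_def path_size_def petal_edges_def)
  qed (use assms(4) in \<open>auto simp: R_class_def flowers_def path_size_def petal_edges_def\<close>)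
  finally show ?thesis by (simp add: path_sum_def)
qed

text \<open>Each new length \<open>m\<close> raises the exponent by one and divides the limit by
  \<open>m\<close> times the new exponent; these divisors build up the product and the
  factorial.\<close>

lemma path_sum_count_tendsto:
  assumes "finite N" "0 \<notin> N"
  shows "(\<lambda>n. path_sum (\<lambda>_. 1) N n / real n ^ card N)
           \<longlonglongrightarrow> (\<Prod>m\<in>N. 1 / real m) / fact (card N)"
  using assms
proof (induction N rule: finite_induct)
  case empty
  show ?case by (simp add: path_sum_empty)
next
  case (insert m N)
  have rec: "path_sum (\<lambda>_. 1) (insert m N) n =
      path_sum (\<lambda>_. 1) (insert m N) (n - m) + path_sum (\<lambda>_. 1) N n" if "n \<ge> m" for n
    using path_sum_insert[of N m n "\<lambda>_. 1"] insert that by simp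
  show ?case
    using step_recurrence_tendsto[of m, OF _ rec insert.IH] insert by (simp add: mult_ac)
qed

lemma path_sum_additive_tendsto:
  fixes w :: "nat \<Rightarrow> real"
  assumes "finite N" "0 \<notin> N"
  shows "(\<lambda>n. path_sum (\<lambda>p. \<Sum>i\<in>#p. w i) N n / real n ^ Suc (card N))
           \<longlonglongrightarrow> (\<Prod>m\<in>N. 1 / real m) * (\<Sum>m\<in>N. w m / real m) / fact (Suc (card N))"
  using assms
proof (induction N rule: finite_induct)
  case empty
  show ?case by (simp add: path_sum_empty)
next
  case (insert m N)
  let ?h = "\<lambda>p. \<Sum>i\<in>#p. w i" and ?M = "insert m N" and ?k = "Suc (card N)"
  let ?P = "\<Prod>m\<in>N. 1 / real m" and ?S = "\<Sum>m\<in>N. w m / real m"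
  \<comment> \<open>Removing a petal \<open>m\<close> loses the weight \<open>w m\<close> once for
    every object containing \<open>m\<close>. By the counting recurrence the number of these is the
    difference of the two counts at \<open>n\<close>, so no term at \<open>n - m\<close> enters the
    increment.\<close>
  let ?a = "\<lambda>n. path_sum ?h N n + w m * (path_sum (\<lambda>_. 1) ?M n - path_sum (\<lambda>_. 1) N n)"
  have m: "m > 0" and N: "0 \<notin> N" using insert by auto
  have rec: "path_sum ?h ?M n = path_sum ?h ?M (n - m) + ?a n" if "n \<ge> m" for n
  proof -
    have "path_sum (\<lambda>p. ?h (add_mset m p)) ?M (n - m) =
        w m * path_sum (\<lambda>_. 1) ?M (n - m) + path_sum ?h ?M (n - m)"
      by (simp add: path_sum_def sum.distrib)
    thus ?thesis
      using path_sum_insert[of N m n ?h] path_sum_insert[of N m n "\<lambda>_. 1"] insert that by simp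
  qed
  have M: "(\<lambda>n. path_sum (\<lambda>_. 1) ?M n / real n ^ ?k) \<longlonglongrightarrow> (1 / real m * ?P) / fact ?k"
    using path_sum_count_tendsto[of ?M] insert by simp
  \<comment> \<open>The count without \<open>m\<close> has order \<open>n ^ card N\<close>, one
    power too low to matter.\<close>
  have "(\<lambda>n. path_sum (\<lambda>_. 1) N n / real n ^ card N * (1 / real n)) \<longlonglongrightarrow> ?P / fact (card N) * 0"
    using insert(1) N by (intro tendsto_intros path_sum_count_tendsto lim_const_over_n)
  hence N0: "(\<lambda>n. path_sum (\<lambda>_. 1) N n / real n ^ ?k) \<longlonglongrightarrow> 0"
    by (simp add: mult.commute)
  have "(\<lambda>n. path_sum ?h N n / real n ^ ?k + w m * (path_sum (\<lambda>_. 1) ?M n / real n ^ ?k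
        - path_sum (\<lambda>_. 1) N n / real n ^ ?k))
      \<longlonglongrightarrow> ?P * ?S / fact ?k + w m * ((1 / real m * ?P) / fact ?k - 0)"
    by (intro tendsto_intros M N0 insert.IH N)
  hence "(\<lambda>n. ?a n / real n ^ ?k) \<longlonglongrightarrow> ?P * (?S + w m / real m) / fact ?k"
    by (simp add: add_divide_distrib diff_divide_distrib right_diff_distrib algebra_simps
        del: power_Suc fact_Suc)
  from step_recurrence_tendsto[OF m rec this]
  have "(\<lambda>n. path_sum ?h ?M n / real n ^ Suc ?k)
      \<longlonglongrightarrow> ?P * (?S + w m / real m) / fact ?k / (real m * real (Suc ?k))" .
  also have "?P * (?S + w m / real m) / fact ?k / (real m * real (Suc ?k)) =
      (1 / real m * ?P) * (w m / real m + ?S) / fact (Suc ?k)"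
    by (subst (2) fact_Suc) (simp add: field_simps del: fact_Suc of_nat_Suc)
  finally show ?case using insert by simp
qed

section \<open>Asymptotics of the coefficients and of the means\<close>

lemma R_gf_nth: "fps_nth (R_gf N) n = path_sum (\<lambda>_. 1) N n"
  by (simp add: R_gf_def gf_def path_sum_def)

text \<open>For each size exactly one object carries the empty flower: the bare path.\<close>

lemma Rstar_gf_nth:
  assumes "0 \<notin> N"
  shows "fps_nth (Rstar_gf N) n = fps_nth (R_gf N) n - 1"
  using assms
  by (simp add: Rstar_gf_eq R_gf_eq divide_one_minus_X_nth sum_subtractf)

theorem theorem3:
  fixes N :: "nat set"
  assumes "finite N" and "N \<noteq> {}" and "0 \<notin> N"
  shows "(\<lambda>n. fps_nth (R_gf N) n) \<sim>[at_top] (\<lambda>n. fps_nth (Rstar_gf N) n) \<and>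
         (\<lambda>n. fps_nth (Rstar_gf N) n) \<sim>[at_top]
           (\<lambda>n. (\<Prod>m\<in>N. 1 / real m) * (real n ^ card N / fact (card N))) \<and>
         (\<lambda>n. fps_nth (Omega_gf petals N) n) \<sim>[at_top]
           (\<lambda>n. 1 / fact (card N + 1) * (\<Prod>m\<in>N. 1 / real m) * (\<Sum>m\<in>N. 1 / real m)
                  * real n ^ (card N + 1)) \<and>
         (\<lambda>n. fps_nth (Omega_gf petal_edges N) n) \<sim>[at_top]
           (\<lambda>n. real (card N) / fact (card N + 1) * (\<Prod>m\<in>N. 1 / real m)
                  * real n ^ (card N + 1)) \<and>
         (\<lambda>n. R_mean petals N n) \<sim>[at_top]
           (\<lambda>n. 1 / real (card N + 1) * (\<Sum>m\<in>N. 1 / real m) * real n) \<and>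
         (\<lambda>n. R_mean petal_edges N n) \<sim>[at_top]
           (\<lambda>n. real (card N) / real (card N + 1) * real n)"
proof -
  define k where "k = card N"
  define P where "P = (\<Prod>m\<in>N. 1 / real m)"
  define S where "S = (\<Sum>m\<in>N. 1 / real m)"
  \<comment> \<open>Positivity of \<open>k\<close>, \<open>P\<close> and \<open>S\<close> makes the
    leading coefficients nonzero, as passing from limits to asymptotic equivalence requires.\<close>
  have k: "k > 0" using assms by (simp add: k_def card_gt_0_iff)
  have pos: "real m > 0" if "m \<in> N" for m using that assms(3) by (cases m) auto
  have P: "P > 0" unfolding P_def by (intro prod_pos) (use pos in auto)
  have S: "S > 0" unfolding S_def by (intro sum_pos) (use pos assms in auto)

  have R: "(\<lambda>n. fps_nth (R_gf N) n / real n ^ k) \<longlonglongrightarrow> P / fact k"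
    using path_sum_count_tendsto[OF assms(1,3)] by (simp add: R_gf_nth k_def P_def)
  \<comment> \<open>As \<open>k > 0\<close>, the one bare path of size \<open>n\<close> is
    negligible against \<open>n ^ k\<close>.\<close>
  have "(\<lambda>n. inverse (real n) ^ k) \<longlonglongrightarrow> 0"
    using tendsto_power[OF lim_inverse_n, of k] k by (simp only: zero_power)
  hence "(\<lambda>n. fps_nth (R_gf N) n / real n ^ k - inverse (real n) ^ k) \<longlonglongrightarrow> P / fact k - 0"
    by (intro tendsto_diff R)
  hence Rstar: "(\<lambda>n. fps_nth (Rstar_gf N) n / real n ^ k) \<longlonglongrightarrow> P / fact k"
    using assms(3) by (simp add: Rstar_gf_nth diff_divide_distrib inverse_eq_divide power_one_over)

  have "(\<Sum>i\<in>#p. 1) = real (petals p)" for p :: flower by (simp add: petals_def)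
  hence petals: "(\<lambda>n. fps_nth (Omega_gf petals N) n / real n ^ (k + 1)) \<longlonglongrightarrow> P * S / fact (k + 1)"
    using path_sum_additive_tendsto[OF assms(1,3), of "\<lambda>_. 1"] assms(3)
    by (simp add: Omega_gf_nth path_sum_def k_def P_def S_def)
  \<comment> \<open>For petal edges the weight is \<open>w m = m\<close>, so each term
    \<open>w m / m\<close> is 1 and the sum over \<open>N\<close> becomes
    \<open>card N\<close>.\<close>
  have "(\<Sum>i\<in>#p. real i) = real (petal_edges p)" for p :: flower
    by (induction p) (auto simp: petal_edges_def)
  moreover have "(\<Sum>m\<in>N. real m / real m) = (\<Sum>m\<in>N. 1)"
    using pos by (intro sum.cong) auto
  ultimately have edges: "(\<lambda>n. fps_nth (Omega_gf petal_edges N) n / real n ^ (k + 1))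
      \<longlonglongrightarrow> P * real k / fact (k + 1)"
    using path_sum_additive_tendsto[OF assms(1,3), of real] assms(3)
    by (simp add: Omega_gf_nth path_sum_def k_def P_def del: divide_self_if)

  have R': "(\<lambda>n. fps_nth (R_gf N) n) \<sim>[at_top] (\<lambda>n. P / fact k * real n ^ k)"
    using P by (intro asymp_equiv_powerI R) auto
  have Rstar': "(\<lambda>n. fps_nth (Rstar_gf N) n) \<sim>[at_top] (\<lambda>n. P / fact k * real n ^ k)"
    using P by (intro asymp_equiv_powerI Rstar) auto
  have petals': "(\<lambda>n. fps_nth (Omega_gf petals N) n)
      \<sim>[at_top] (\<lambda>n. P * S / fact (k + 1) * real n ^ (k + 1))"
    using P S by (intro asymp_equiv_powerI petals) auto
  have edges': "(\<lambda>n. fps_nth (Omega_gf petal_edges N) n)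
      \<sim>[at_top] (\<lambda>n. P * real k / fact (k + 1) * real n ^ (k + 1))"
    using P k by (intro asymp_equiv_powerI edges) auto
  \<comment> \<open>Both sides vanish at \<open>n = 0\<close>, so this holds for every
    \<open>n\<close> and can be rewritten under the abstraction.\<close>
  have ratio: "(A * real n ^ (k + 1)) / (P / fact k * real n ^ k) = A * fact k / P * real n"
    for A and n using P by (cases "n = 0") (auto simp: field_simps)
  have mean1: "(\<lambda>n. R_mean petals N n)
      \<sim>[at_top] (\<lambda>n. P * S / fact (k + 1) * fact k / P * real n)"
    using asymp_equiv_divide[OF petals' R'] unfolding ratio by (simp only: R_mean_def)
  have mean2: "(\<lambda>n. R_mean petal_edges N n)
      \<sim>[at_top] (\<lambda>n. P * real k / fact (k + 1) * fact k / P * real n)"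
    using asymp_equiv_divide[OF edges' R'] unfolding ratio by (simp only: R_mean_def)
  have coeff: "P * A / fact (k + 1) * fact k / P = A / real (k + 1)" for A
    using P by (simp del: of_nat_Suc)
  show ?thesis
    using asymp_equiv_trans[OF R' asymp_equiv_symI[OF Rstar']] Rstar' petals' edges'
      mean1 mean2
    unfolding coeff by (simp add: k_def P_def S_def mult_ac)
qed

end
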